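(* Let $x$ be a vector of variables, let $f(x,y,z)$ and $g(x,u,v)$ be vectors of polynomial terms of the same dimension as $x$, let $y\in Y$, $z\in Z$, $u\in U$, $v\in V$ be first-order real-arithmetic formulas whose only free variables are $y,z,u,v$ respectively, defining compact sets, with $f$ bounded on $\mathbb R^n\times Y\times Z$ and $g$ bounded on $\mathbb R^n\times U\times V$. If the formula $\forall u\,(u\in U\to\exists y\,(y\in Y\land\forall z\,(z\in Z\to\exists v\,(v\in V\land\forall x\,(f(x,y,z)=g(x,u,v))))))$ is valid, then for every dGL formula $F$ the formula $[x'=g(x,u,v)\ \&\ u\in U\ \&\ v\in V]F \to [x'=f(x,y,z)\ \&\ y\in Y\ \&\ z\in Z]F$ is valid.
   Context: Semantics of $[\cdot]$ for differential games (dGL). A state $\omega$ maps variables to reals; $[\![F]\!]$ is the set of states where $F$ holds. For a differential game $D\equiv(x'=f(x,y,z)\ \&\ y\in Y\ \&\ z\in Z)$ and $T\ge0$, let $\mathcal M_Y$, $\mathcal M_Z$ be the measurable functions $[0,T]\to Y$, $[0,T]\to Z$; a nonanticipative strategy is a map $\beta:\mathcal M_Y\to\mathcal M_Z$ such that for all $s\in[0,T]$, if $y=\hat y$ a.e. on $[0,s]$ then $\beta(y)=\beta(\hat y)$ a.e. on $[0,s]$; $\Delta_Z$ denotes the set of these. The response $x^{y,z}_\omega(\zeta)$ is the state equal to $\omega$ except that $x$ takes the value at time $\zeta$ of the unique Carathéodory solution (absolutely continuous, satisfying the ODE a.e.) of $x'(s)=f(x(s),y(s),z(s))$, $x(0)=\omega(x)$.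 Then $\omega\in[\![[D]F]\!]$ iff for all $T\ge0$ and all $\beta\in\Delta_Z$ there is $y\in\mathcal M_Y$ such that for all $\zeta\in[0,T]$, $x^{y,\beta(y)}_\omega(\zeta)\in[\![F]\!]$. A formula is valid if true in all states. *)

theory Defs
  imports "HOL-Analysis.Analysis"
begin

section \<open>Syntax of differential game logic\<close>

type_synonym ident = string
type_synonym state = "ident \<Rightarrow> real"

datatype trm = Var ident | Const real | Plus trm trm | Times trm trm

text \<open>\<^term>\<open>DGame x f y Y z Z\<close> is the differential game
  $x' = f(x,y,z) \mathbin{\&} y \in Y \mathbin{\&} z \in Z$. Angel controls $z$ and the duration,
  Demon controls $y$.\<close>

datatype fml =
    Ge trm trm
  | NotF fml
  | AndF fml fml
  | ExF ident fml
  | Dia game fml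
  | Box game fml
and game =
    DGame "ident list" "trm list" "ident list" fml "ident list" fml
  | Assign ident trm
  | Test fml
  | Choice game game
  | Seq game game
  | Loop game
  | Dual game

definition ImpF :: "fml \<Rightarrow> fml \<Rightarrow> fml" where
  "ImpF \<phi> \<psi> = NotF (AndF \<phi> (NotF \<psi>))"

definition AllF :: "ident \<Rightarrow> fml \<Rightarrow> fml" where
  "AllF w \<phi> = NotF (ExF w (NotF \<phi>))"

definition EqF :: "trm \<Rightarrow> trm \<Rightarrow> fml" where
  "EqF \<theta> \<eta> = AndF (Ge \<theta> \<eta>) (Ge \<eta> \<theta>)"

definition TrueF :: fml where
  "TrueF = Ge (Const 0) (Const 0)"

definition ExsF :: "ident list \<Rightarrow> fml \<Rightarrow> fml" where
  "ExsF ws \<phi> = foldr ExF ws \<phi>"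

definition AllsF :: "ident list \<Rightarrow> fml \<Rightarrow> fml" where
  "AllsF ws \<phi> = foldr AllF ws \<phi>"

definition VecEqF :: "trm list \<Rightarrow> trm list \<Rightarrow> fml" where
  "VecEqF \<theta>s \<eta>s = foldr AndF (map2 EqF \<theta>s \<eta>s) TrueF"

primrec trm_vars :: "trm \<Rightarrow> ident set" where
  "trm_vars (Var w) = {w}"
| "trm_vars (Const c) = {}"
| "trm_vars (Plus \<theta> \<eta>) = trm_vars \<theta> \<union> trm_vars \<eta>"
| "trm_vars (Times \<theta> \<eta>) = trm_vars \<theta> \<union> trm_vars \<eta>"

text \<open>\<open>fo_over W \<phi>\<close>: \<open>\<phi>\<close> is a formula of first-order real arithmetic (no modalities) all of whose
  free variables are in \<open>W\<close>.\<close>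

fun fo_over :: "ident set \<Rightarrow> fml \<Rightarrow> bool" where
  "fo_over W (Ge \<theta> \<eta>) \<longleftrightarrow> trm_vars \<theta> \<union> trm_vars \<eta> \<subseteq> W"
| "fo_over W (NotF \<phi>) \<longleftrightarrow> fo_over W \<phi>"
| "fo_over W (AndF \<phi> \<psi>) \<longleftrightarrow> fo_over W \<phi> \<and> fo_over W \<psi>"
| "fo_over W (ExF w \<phi>) \<longleftrightarrow> fo_over (insert w W) \<phi>"
| "fo_over W (Dia \<alpha> \<phi>) \<longleftrightarrow> False"
| "fo_over W (Box \<alpha> \<phi>) \<longleftrightarrow> False"


section \<open>Vectors of variables\<close>

text \<open>Vectors of dimension \<open>n\<close> are the elements of \<^term>\<open>topspace (Euclidean_space n)\<close>, that is,
  functions \<^typ>\<open>nat \<Rightarrow> real\<close> that vanish from index \<open>n\<close> on.\<close>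

type_synonym vec = "nat \<Rightarrow> real"

definition state_vec :: "state \<Rightarrow> ident list \<Rightarrow> vec" where
  "state_vec \<omega> ws = (\<lambda>i. if i < length ws then \<omega> (ws ! i) else 0)"

definition upd :: "state \<Rightarrow> ident list \<Rightarrow> vec \<Rightarrow> state" where
  "upd \<omega> ws a = (\<lambda>w. case map_of (zip ws (map a [0..<length ws])) w of
                        Some r \<Rightarrow> r | None \<Rightarrow> \<omega> w)"

text \<open>The subset of $\mathbb{R}^k$ defined by a formula with semantics \<open>S\<close> in the variables \<open>ws\<close>.
  It does not depend on \<open>\<omega>\<close> if \<open>ws\<close> are the only free variables.\<close>

definition region :: "state \<Rightarrow> ident list \<Rightarrow> state set \<Rightarrow> vec set" where
  "region \<omega> ws S = {a \<in> topspace (Euclidean_space (length ws)). upd \<omega> ws a \<in> S}"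

primrec trm_sem :: "trm \<Rightarrow> state \<Rightarrow> real" where
  "trm_sem (Var w) \<omega> = \<omega> w"
| "trm_sem (Const c) \<omega> = c"
| "trm_sem (Plus \<theta> \<eta>) \<omega> = trm_sem \<theta> \<omega> + trm_sem \<eta> \<omega>"
| "trm_sem (Times \<theta> \<eta>) \<omega> = trm_sem \<theta> \<omega> * trm_sem \<eta> \<omega>"

text \<open>The \<open>i\<close>-th component of $f(a,b,c)$; other variables, if any, are read from \<open>\<omega>\<close>.\<close>

definition rhs ::
  "ident list \<Rightarrow> trm list \<Rightarrow> ident list \<Rightarrow> ident list \<Rightarrow> state \<Rightarrow> vec \<Rightarrow> vec \<Rightarrow> vec \<Rightarrow> nat \<Rightarrow> real" where
  "rhs x f y z \<omega> a b c i = trm_sem (f ! i) (upd (upd (upd \<omega> x a) y b) z c)"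


section \<open>Controls, strategies and responses\<close>

definition controls :: "real \<Rightarrow> vec set \<Rightarrow> (real \<Rightarrow> vec) set" where
  "controls T A = ({0..T} \<rightarrow>\<^sub>E A) \<inter> borel_measurable (lebesgue_on {0..T})"

definition strategies :: "real \<Rightarrow> vec set \<Rightarrow> vec set \<Rightarrow> ((real \<Rightarrow> vec) \<Rightarrow> (real \<Rightarrow> vec)) set" where
  "strategies T A B = {\<beta> \<in> controls T A \<rightarrow>\<^sub>E controls T B.
     \<forall>s\<in>{0..T}. \<forall>p\<in>controls T A. \<forall>q\<in>controls T A.
       (AE t in lebesgue_on {0..s}. p t = q t) \<longrightarrow>
       (AE t in lebesgue_on {0..s}. \<beta> p t = \<beta> q t)}"

definition abs_continuous_on :: "real \<Rightarrow> real \<Rightarrow> (real \<Rightarrow> real) \<Rightarrow> bool" where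
  "abs_continuous_on a b h \<longleftrightarrow> (\<forall>\<epsilon>>0. \<exists>\<delta>>0. \<forall>D :: (real \<times> real) set.
     finite D \<and> (\<forall>(c, d)\<in>D. a \<le> c \<and> c \<le> d \<and> d \<le> b) \<and>
     pairwise (\<lambda>(c, d) (c', d'). {c<..<d} \<inter> {c'<..<d'} = {}) D \<and>
     (\<Sum>(c, d)\<in>D. d - c) < \<delta>
     \<longrightarrow> (\<Sum>(c, d)\<in>D. \<bar>h d - h c\<bar>) < \<epsilon>)"

definition caratheodory_solution ::
  "ident list \<Rightarrow> trm list \<Rightarrow> ident list \<Rightarrow> ident list \<Rightarrow> state \<Rightarrow> real \<Rightarrow>
   (real \<Rightarrow> vec) \<Rightarrow> (real \<Rightarrow> vec) \<Rightarrow> (real \<Rightarrow> vec) \<Rightarrow> bool" where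
  "caratheodory_solution x f y z \<omega> T p q \<xi> \<longleftrightarrow>
     \<xi> \<in> {0..T} \<rightarrow>\<^sub>E topspace (Euclidean_space (length x)) \<and>
     \<xi> 0 = state_vec \<omega> x \<and>
     (\<forall>i<length x. abs_continuous_on 0 T (\<lambda>s. \<xi> s i)) \<and>
     (AE s in lebesgue_on {0..T}. \<forall>i<length x.
        ((\<lambda>t. \<xi> t i) has_real_derivative rhs x f y z \<omega> (\<xi> s) (p s) (q s) i) (at s within {0..T}))"

definition response ::
  "ident list \<Rightarrow> trm list \<Rightarrow> ident list \<Rightarrow> ident list \<Rightarrow> state \<Rightarrow> real \<Rightarrow>
   (real \<Rightarrow> vec) \<Rightarrow> (real \<Rightarrow> vec) \<Rightarrow> real \<Rightarrow> state" where
  "response x f y z \<omega> T p q \<zeta> = upd \<omega> x ((THE \<xi>. caratheodory_solution x f y z \<omega> T p q \<xi>) \<zeta>)"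


section \<open>Semantics\<close>

text \<open>\<open>angel \<alpha> X\<close> and \<open>demon \<alpha> X\<close> are the states from which Angel, respectively Demon, can win
  \<open>\<alpha>\<close> into \<open>X\<close>. The clauses for \<^const>\<open>Loop\<close> are least and greatest fixpoints.\<close>

fun fml_sem :: "fml \<Rightarrow> state set"
  and angel :: "game \<Rightarrow> state set \<Rightarrow> state set"
  and demon :: "game \<Rightarrow> state set \<Rightarrow> state set" where
  "fml_sem (Ge \<theta> \<eta>) = {\<omega>. trm_sem \<theta> \<omega> \<ge> trm_sem \<eta> \<omega>}"
| "fml_sem (NotF \<phi>) = - fml_sem \<phi>"
| "fml_sem (AndF \<phi> \<psi>) = fml_sem \<phi> \<inter> fml_sem \<psi>"
| "fml_sem (ExF w \<phi>) = {\<omega>. \<exists>r. fun_upd \<omega> w r \<in> fml_sem \<phi>}"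
| "fml_sem (Dia \<alpha> \<phi>) = angel \<alpha> (fml_sem \<phi>)"
| "fml_sem (Box \<alpha> \<phi>) = demon \<alpha> (fml_sem \<phi>)"

| "angel (DGame x f y Y z Z) X = {\<omega>. \<exists>T\<ge>0.
     \<exists>\<beta>\<in>strategies T (region \<omega> y (fml_sem Y)) (region \<omega> z (fml_sem Z)).
     \<forall>p\<in>controls T (region \<omega> y (fml_sem Y)).
     \<exists>\<zeta>\<in>{0..T}. response x f y z \<omega> T p (\<beta> p) \<zeta> \<in> X}"
| "angel (Assign w \<theta>) X = {\<omega>. fun_upd \<omega> w (trm_sem \<theta> \<omega>) \<in> X}"
| "angel (Test \<phi>) X = fml_sem \<phi> \<inter> X"
| "angel (Choice \<alpha> \<gamma>) X = angel \<alpha> X \<union> angel \<gamma> X"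
| "angel (Seq \<alpha> \<gamma>) X = angel \<alpha> (angel \<gamma> X)"
| "angel (Loop \<alpha>) X = \<Inter>{S. X \<union> angel \<alpha> S \<subseteq> S}"
| "angel (Dual \<alpha>) X = - angel \<alpha> (- X)"

| "demon (DGame x f y Y z Z) X = {\<omega>. \<forall>T\<ge>0.
     \<forall>\<beta>\<in>strategies T (region \<omega> y (fml_sem Y)) (region \<omega> z (fml_sem Z)).
     \<exists>p\<in>controls T (region \<omega> y (fml_sem Y)).
     \<forall>\<zeta>\<in>{0..T}. response x f y z \<omega> T p (\<beta> p) \<zeta> \<in> X}"
| "demon (Assign w \<theta>) X = {\<omega>. fun_upd \<omega> w (trm_sem \<theta> \<omega>) \<in> X}"
| "demon (Test \<phi>) X = - fml_sem \<phi> \<union> X"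
| "demon (Choice \<alpha> \<gamma>) X = demon \<alpha> X \<inter> demon \<gamma> X"
| "demon (Seq \<alpha> \<gamma>) X = demon \<alpha> (demon \<gamma> X)"
| "demon (Loop \<alpha>) X = \<Union>{S. S \<subseteq> X \<inter> demon \<alpha> S}"
| "demon (Dual \<alpha>) X = - demon \<alpha> (- X)"

definition valid :: "fml \<Rightarrow> bool" where
  "valid \<phi> \<longleftrightarrow> (\<forall>\<omega>. \<omega> \<in> fml_sem \<phi>)"


section \<open>Well-formedness\<close>

definition wf_dgame ::
  "ident list \<Rightarrow> trm list \<Rightarrow> ident list \<Rightarrow> fml \<Rightarrow> ident list \<Rightarrow> fml \<Rightarrow> bool" where
  "wf_dgame x f y Y z Z \<longleftrightarrow>
     distinct (x @ y @ z) \<and>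
     length f = length x \<and>
     (\<forall>\<theta>\<in>set f. trm_vars \<theta> \<subseteq> set x \<union> set y \<union> set z) \<and>
     fo_over (set y) Y \<and> fo_over (set z) Z \<and>
     (\<forall>\<omega>. compactin (Euclidean_space (length y)) (region \<omega> y (fml_sem Y))) \<and>
     (\<forall>\<omega>. compactin (Euclidean_space (length z)) (region \<omega> z (fml_sem Z))) \<and>
     (\<exists>C. \<forall>\<omega>. \<forall>a\<in>topspace (Euclidean_space (length x)).
        \<forall>b\<in>region \<omega> y (fml_sem Y). \<forall>c\<in>region \<omega> z (fml_sem Z).
        \<forall>i<length x. \<bar>rhs x f y z \<omega> a b c i\<bar> \<le> C)"

primrec wf_fml :: "fml \<Rightarrow> bool" and wf_game :: "game \<Rightarrow> bool" where
  "wf_fml (Ge \<theta> \<eta>) \<longleftrightarrow> True"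
| "wf_fml (NotF \<phi>) \<longleftrightarrow> wf_fml \<phi>"
| "wf_fml (AndF \<phi> \<psi>) \<longleftrightarrow> wf_fml \<phi> \<and> wf_fml \<psi>"
| "wf_fml (ExF w \<phi>) \<longleftrightarrow> wf_fml \<phi>"
| "wf_fml (Dia \<alpha> \<phi>) \<longleftrightarrow> wf_game \<alpha> \<and> wf_fml \<phi>"
| "wf_fml (Box \<alpha> \<phi>) \<longleftrightarrow> wf_game \<alpha> \<and> wf_fml \<phi>"
| "wf_game (DGame x f y Y z Z) \<longleftrightarrow> wf_dgame x f y Y z Z"
| "wf_game (Assign w \<theta>) \<longleftrightarrow> True"
| "wf_game (Test \<phi>) \<longleftrightarrow> wf_fml \<phi>"
| "wf_game (Choice \<alpha> \<gamma>) \<longleftrightarrow> wf_game \<alpha> \<and> wf_game \<gamma>"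
| "wf_game (Seq \<alpha> \<gamma>) \<longleftrightarrow> wf_game \<alpha> \<and> wf_game \<gamma>"
| "wf_game (Loop \<alpha>) \<longleftrightarrow> wf_game \<alpha>"
| "wf_game (Dual \<alpha>) \<longleftrightarrow> wf_game \<alpha>"

end

theory Submission
  imports Defs
begin

text \<open>The relation between control values expressed by the premise is compact, so measurable selection
  turns its quantifier alternation into Borel maps $h : U \<rightarrow> Y$ and $k$ with
  $f(x,h(u),z) = g(x,u,k(u,h(u),z))$ for all $x$. Angel's strategy $\<beta>$ for $f$ then induces the
  nonanticipative strategy $u \<mapsto> k(u, h \<circ> u, \<beta>(h \<circ> u))$ for $g$. If $u$ is Demon's winning
  answer to it, then $h \<circ> u$ answers $\<beta>$, because both games follow the same differential
  equation.\<close>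

section \<open>Measurable selection\<close>

lemma continuous_on_component: "continuous_on S (\<lambda>p::nat \<Rightarrow> real. p i)"
  by (rule continuous_on_product_coordinates[THEN continuous_on_subset]) simp

lemma compact_component_min:
  fixes S :: "(nat \<Rightarrow> real) set"
  assumes "compact S" "S \<noteq> {}"
  obtains p where "p \<in> S" "\<And>q. q \<in> S \<Longrightarrow> p i \<le> q i"
  using continuous_attains_inf[OF assms continuous_on_component[of S i]] by blast

lemma closed_component_le: "closed {p::nat \<Rightarrow> real. p i \<le> c}"
  by (intro closed_Collect_le continuous_on_component continuous_on_const)

text \<open>Minimising one coordinate over every value keeps a compact-valued multifunction measurable, so
  that the lexicographic minimum is a measurable selection.\<close>

lemma measurable_multifunction_min:
  fixes R :: "'a \<Rightarrow> (nat \<Rightarrow> real) set"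
  assumes cpt: "\<And>a. a \<in> space M \<Longrightarrow> compact (R a)"
    and ne: "\<And>a. a \<in> space M \<Longrightarrow> R a \<noteq> {}"
    and meas: "\<And>C. closed C \<Longrightarrow> {a \<in> space M. R a \<inter> C \<noteq> {}} \<in> sets M"
  obtains R' where "\<And>a. a \<in> space M \<Longrightarrow> compact (R' a)"
    and "\<And>a. a \<in> space M \<Longrightarrow> R' a \<noteq> {}"
    and "\<And>a. a \<in> space M \<Longrightarrow> R' a \<subseteq> R a"
    and "\<And>C. closed C \<Longrightarrow> {a \<in> space M. R' a \<inter> C \<noteq> {}} \<in> sets M"
    and "\<And>a p q. a \<in> space M \<Longrightarrow> p \<in> R' a \<Longrightarrow> q \<in> R' a \<Longrightarrow> p i = q i"
proof -
  have "\<exists>m. \<forall>a\<in>space M. (\<exists>p\<in>R a. p i = m a) \<and> (\<forall>q\<in>R a. m a \<le> q i)"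
    by (rule bchoice) (metis compact_component_min cpt ne)
  then obtain m where m: "\<And>a. a \<in> space M \<Longrightarrow> \<exists>p\<in>R a. p i = m a"
    "\<And>a q. a \<in> space M \<Longrightarrow> q \<in> R a \<Longrightarrow> m a \<le> q i" by blast
  \<comment> \<open>The minimum is attained, so \<open>m a \<le> c\<close> says exactly that
    \<open>R a\<close> hits a closed half-space. Measurability of hitting thus becomes measurability
    of \<open>m\<close>.\<close>
  have "{a \<in> space M. m a \<le> c} = {a \<in> space M. R a \<inter> {p. p i \<le> c} \<noteq> {}}" for c
    using m by (fastforce intro: order_trans)
  then have m_meas: "m \<in> borel_measurable M"
    using meas[OF closed_component_le] by (simp add: borel_measurable_iff_le)
  define R' where "R' a = R a \<inter> {p. p i \<le> m a}" for a
  show ?thesis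
  proof (rule that[of R'])
    fix a assume a: "a \<in> space M"
    show "compact (R' a)"
      unfolding R'_def using cpt[OF a] closed_component_le by blast
    show "R' a \<noteq> {}" using m(1)[OF a] by (auto simp: R'_def)
    show "R' a \<subseteq> R a" by (simp add: R'_def)
    have "p i = m a" if "p \<in> R' a" for p
      using that m(2)[OF a, of p] by (simp add: R'_def)
    then show "p i = q i" if "p \<in> R' a" "q \<in> R' a" for p q using that by metis
  next
    fix C :: "(nat \<Rightarrow> real) set" assume C: "closed C"
    \<comment> \<open>The cut at \<open>m a\<close> varies with \<open>a\<close>, so
      \<open>meas\<close> does not apply to it. It is replaced by the countably many fixed cuts at
      rationals above \<open>m a\<close>.\<close>
    have iff: "R' a \<inter> C \<noteq> {} \<longleftrightarrow> (\<forall>c::rat. m a < of_rat c \<longrightarrow> R a \<inter> (C \<inter> {p. p i \<le> of_rat c}) \<noteq> {})"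
      if a: "a \<in> space M" for a
    proof
      assume "R' a \<inter> C \<noteq> {}"
      then obtain p where p: "p \<in> R a" "p i \<le> m a" "p \<in> C" unfolding R'_def by blast
      show "\<forall>c::rat. m a < of_rat c \<longrightarrow> R a \<inter> (C \<inter> {p. p i \<le> of_rat c}) \<noteq> {}"
      proof (intro allI impI)
        fix c :: rat assume "m a < of_rat c"
        then have "p i \<le> of_rat c" using p(2) by (meson less_imp_le order_trans)
        then show "R a \<inter> (C \<inter> {p. p i \<le> of_rat c}) \<noteq> {}" using p by blast
      qed
    next
      assume *: "\<forall>c::rat. m a < of_rat c \<longrightarrow> R a \<inter> (C \<inter> {p. p i \<le> of_rat c}) \<noteq> {}"
      \<comment> \<open>Some rational exceeds \<open>m a\<close>, so the hypothesis is not vacuous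
        and \<open>R a \<inter> C\<close> is nonempty. Its point with least coordinate
        \<open>i\<close> must lie in the cut: a rational strictly between \<open>m a\<close> and
        \<open>p i\<close> would contradict minimality.\<close>
      obtain c0 :: rat where "m a < of_rat c0" using of_rat_dense[OF less_add_one] by blast
      from *[rule_format, OF this] have "R a \<inter> C \<noteq> {}" by blast
      moreover have "compact (R a \<inter> C)" using cpt[OF a] C by (rule compact_Int_closed)
      ultimately obtain p where p: "p \<in> R a \<inter> C" "\<And>q. q \<in> R a \<inter> C \<Longrightarrow> p i \<le> q i"
        using compact_component_min by metis
      have "p i \<le> m a"
      proof (rule ccontr)
        assume "\<not> p i \<le> m a"
        then obtain c :: rat where c: "m a < of_rat c" "of_rat c < p i"
          using of_rat_dense[of "m a" "p i"] by (meson not_le)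
        then obtain q where "q \<in> R a \<inter> C" "q i \<le> of_rat c" using *[rule_format, OF c(1)] by blast
        then show False using p(2)[of q] c(2) by (meson leD order_trans)
      qed
      then show "R' a \<inter> C \<noteq> {}" using p(1) unfolding R'_def by blast
    qed
    have "{a \<in> space M. R' a \<inter> C \<noteq> {}} = {a \<in> space M. \<forall>c::rat. m a < of_rat c \<longrightarrow>
        a \<in> {a \<in> space M. R a \<inter> (C \<inter> {p. p i \<le> of_rat c}) \<noteq> {}}}"
      by (intro Collect_cong conj_cong refl) (simp add: iff)
    also have "\<dots> \<in> sets M"
    proof -
      have [measurable]: "{a \<in> space M. R a \<inter> (C \<inter> {p. p i \<le> of_rat c}) \<noteq> {}} \<in> sets M" for c
        using C closed_component_le by (intro meas closed_Int)
      note m_meas[measurable]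
      show ?thesis by measurable
    qed
    finally show "{a \<in> space M. R' a \<inter> C \<noteq> {}} \<in> sets M" .
  qed
qed

text \<open>Induction on the number of coordinates fixed: compactness, nonemptiness and
  measurability of hitting closed sets survive each minimisation, so the next coordinate can be
  minimised on what remains. Earlier coordinates stay fixed because the sets only shrink.\<close>

lemma measurable_multifunction_lex_min:
  fixes R :: "'a \<Rightarrow> (nat \<Rightarrow> real) set"
  assumes "\<And>a. a \<in> space M \<Longrightarrow> compact (R a)"
    and "\<And>a. a \<in> space M \<Longrightarrow> R a \<noteq> {}"
    and "\<And>C. closed C \<Longrightarrow> {a \<in> space M. R a \<inter> C \<noteq> {}} \<in> sets M"
  shows "\<exists>R'. (\<forall>a\<in>space M. compact (R' a) \<and> R' a \<noteq> {} \<and> R' a \<subseteq> R a \<and>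
      (\<forall>p\<in>R' a. \<forall>q\<in>R' a. \<forall>i<n. p i = q i)) \<and>
    (\<forall>C. closed C \<longrightarrow> {a \<in> space M. R' a \<inter> C \<noteq> {}} \<in> sets M)"
proof (induction n)
  case 0
  then show ?case using assms by (intro exI[of _ R]) auto
next
  case (Suc n)
  then obtain R1 where R1: "\<And>a. a \<in> space M \<Longrightarrow> compact (R1 a)"
      "\<And>a. a \<in> space M \<Longrightarrow> R1 a \<noteq> {}"
      "\<And>a. a \<in> space M \<Longrightarrow> R1 a \<subseteq> R a"
      "\<And>a p q i. a \<in> space M \<Longrightarrow> p \<in> R1 a \<Longrightarrow> q \<in> R1 a \<Longrightarrow> i < n \<Longrightarrow> p i = q i"
      "\<And>C. closed C \<Longrightarrow> {a \<in> space M. R1 a \<inter> C \<noteq> {}} \<in> sets M"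
    by (smt (verit, del_insts))
  obtain R2 where R2: "\<And>a. a \<in> space M \<Longrightarrow> compact (R2 a)"
    "\<And>a. a \<in> space M \<Longrightarrow> R2 a \<noteq> {}"
    "\<And>a. a \<in> space M \<Longrightarrow> R2 a \<subseteq> R1 a"
    "\<And>C. closed C \<Longrightarrow> {a \<in> space M. R2 a \<inter> C \<noteq> {}} \<in> sets M"
    "\<And>a p q. a \<in> space M \<Longrightarrow> p \<in> R2 a \<Longrightarrow> q \<in> R2 a \<Longrightarrow> p n = q n"
    by (rule measurable_multifunction_min[OF R1(1,2,5), where i = n]) blast+
  show ?case
  proof (intro exI[of _ R2] conjI ballI allI impI)
    fix a p q i assume "a \<in> space M" "p \<in> R2 a" "q \<in> R2 a" "i < Suc n"
    then show "p i = q i" using R2(3,5) R1(4) by (metis less_antisym subsetD)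
  qed (use R1(3) R2(1-4) in \<open>simp_all add: subset_trans[OF R2(3) R1(3)]\<close>)
qed

text \<open>A finite-dimensional, compact-valued case of the Kuratowski--Ryll-Nardzewski theorem.
  The coordinates from \<open>n\<close> on vanish, so minimising the first \<open>n\<close> leaves a
  single point, which is the selection.\<close>

lemma measurable_selection:
  fixes R :: "'a \<Rightarrow> (nat \<Rightarrow> real) set"
  assumes "\<And>a. a \<in> space M \<Longrightarrow> compact (R a)"
    and "\<And>a. a \<in> space M \<Longrightarrow> R a \<noteq> {}"
    and "\<And>C. closed C \<Longrightarrow> {a \<in> space M. R a \<inter> C \<noteq> {}} \<in> sets M"
    and vanish: "\<And>a p i. a \<in> space M \<Longrightarrow> p \<in> R a \<Longrightarrow> n \<le> i \<Longrightarrow> p i = 0"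
  obtains s where "s \<in> borel_measurable M" "\<And>a. a \<in> space M \<Longrightarrow> s a \<in> R a"
proof -
  obtain R' where R': "\<And>a. a \<in> space M \<Longrightarrow> R' a \<noteq> {}" "\<And>a. a \<in> space M \<Longrightarrow> R' a \<subseteq> R a"
    "\<And>a p q i. a \<in> space M \<Longrightarrow> p \<in> R' a \<Longrightarrow> q \<in> R' a \<Longrightarrow> i < n \<Longrightarrow> p i = q i"
    "\<And>C. closed C \<Longrightarrow> {a \<in> space M. R' a \<inter> C \<noteq> {}} \<in> sets M"
    using measurable_multifunction_lex_min[OF assms(1-3), where n = n] by (smt (verit, del_insts))
  have "\<exists>s. \<forall>a\<in>space M. s a \<in> R' a" by (rule bchoice) (use R'(1) in blast)
  then obtain s where s: "\<And>a. a \<in> space M \<Longrightarrow> s a \<in> R' a" by blast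
  have single: "p = s a" if "a \<in> space M" "p \<in> R' a" for a p
  proof
    fix i show "p i = s a i"
    proof (cases "i < n")
      case True then show ?thesis using R'(3) s that by blast
    next
      case False then show ?thesis using vanish R'(2) s that by (metis linorder_not_less subsetD)
    qed
  qed
  show ?thesis
  proof (rule that)
    show "s \<in> borel_measurable M"
    proof (rule borel_measurableI)
      fix G :: "(nat \<Rightarrow> real) set" assume "open G"
      then have "space M - {a \<in> space M. R' a \<inter> - G \<noteq> {}} \<in> sets M"
        by (intro sets.compl_sets R'(4)) auto
      \<comment> \<open>As \<open>R' a\<close> contains only \<open>s a\<close>, hitting the closed
        complement of \<open>G\<close> means that \<open>s a\<close> lies outside
        \<open>G\<close>.\<close>
      moreover have "s -` G \<inter> space M = space M - {a \<in> space M. R' a \<inter> - G \<noteq> {}}"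
        using s single by blast
      ultimately show "s -` G \<inter> space M \<in> sets M" by simp
    qed
    show "s a \<in> R a" if "a \<in> space M" for a using s R'(2) that by blast
  qed
qed

text \<open>The points whose fibre hits a closed set form a projection of a compact set, hence a
  closed set. This supplies the measurability that the selection needs.\<close>

lemma compact_relation_selection:
  fixes K :: "('a::t2_space \<times> (nat \<Rightarrow> real)) set"
  assumes "compact K" and vanish: "\<And>a p i. (a, p) \<in> K \<Longrightarrow> n \<le> i \<Longrightarrow> p i = 0"
  obtains s where "s \<in> borel_measurable (restrict_space borel (fst ` K))"
    "\<And>a. a \<in> fst ` K \<Longrightarrow> (a, s a) \<in> K"
proof -
  let ?M = "restrict_space borel (fst ` K)"
  have sp: "space ?M = fst ` K" by (simp add: space_restrict_space)
  have proj: "compact (fst ` (K \<inter> A \<times> C))" if "closed A" "closed C" for A C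
    using assms(1) that by (intro compact_continuous_image continuous_intros compact_Int_closed closed_Times)
  have fibre: "{p. (a, p) \<in> K} = snd ` (K \<inter> {a} \<times> UNIV)" for a by force
  obtain s where "s \<in> borel_measurable ?M" "\<And>a. a \<in> space ?M \<Longrightarrow> s a \<in> {p. (a, p) \<in> K}"
  proof (rule measurable_selection[of ?M "\<lambda>a. {p. (a, p) \<in> K}" n])
    show "compact {p. (a, p) \<in> K}" for a
      unfolding fibre using assms(1)
      by (intro compact_continuous_image continuous_intros compact_Int_closed closed_Times) auto
    show "{p. (a, p) \<in> K} \<noteq> {}" if "a \<in> space ?M" for a using that by (force simp: sp)
    show "{a \<in> space ?M. {p. (a, p) \<in> K} \<inter> C \<noteq> {}} \<in> sets ?M" if "closed C" for C
    proof -
      have "{a \<in> space ?M. {p. (a, p) \<in> K} \<inter> C \<noteq> {}} = fst ` K \<inter> fst ` (K \<inter> UNIV \<times> C)"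
        by (force simp: sp)
      then show ?thesis
        using compact_imp_closed[OF proj[OF closed_UNIV that]] by (auto simp: sets_restrict_space)
    qed
    show "p i = 0" if "p \<in> {p. (a, p) \<in> K}" "n \<le> i" for a p i using vanish that by blast
  qed blast
  then show ?thesis using that by (auto simp: sp)
qed


section \<open>Updates and coincidence\<close>

lemma map_of_zip_first:
  assumes "i < length ws" "\<And>j. j < i \<Longrightarrow> ws ! j \<noteq> ws ! i" "length ws = length rs"
  shows "map_of (zip ws rs) (ws ! i) = Some (rs ! i)"
  using assms(3,1,2)
proof (induction ws rs arbitrary: i rule: list_induct2)
  case (Cons w ws r rs)
  show ?case
  proof (cases i)
    case (Suc k)
    have "w \<noteq> ws ! k" using Cons.prems(2)[of 0] Suc by simp
    moreover have "ws ! j \<noteq> ws ! k" if "j < k" for j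
      using Cons.prems(2)[of "Suc j"] Suc that by simp
    ultimately show ?thesis using Cons.IH[of k] Cons.prems(1) Suc by simp
  qed simp
qed simp

text \<open>\<open>map_of\<close> returns the first match, so the first occurrence is the one that
  \<open>upd\<close> reads. With it \<open>upd_apply\<close> covers lists with repetitions as
  well.\<close>

definition var_index :: "ident list \<Rightarrow> ident \<Rightarrow> nat" where
  "var_index ws w = (LEAST i. i < length ws \<and> ws ! i = w)"

lemma var_index:
  assumes "w \<in> set ws"
  shows "var_index ws w < length ws" "ws ! var_index ws w = w"
proof -
  have "\<exists>i. i < length ws \<and> ws ! i = w" using assms by (simp add: in_set_conv_nth)
  from LeastI_ex[OF this] show "var_index ws w < length ws" "ws ! var_index ws w = w"
    by (simp_all add: var_index_def)
qed

lemma upd_apply: "upd \<omega> ws a w = (if w \<in> set ws then a (var_index ws w) else \<omega> w)"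
proof (cases "w \<in> set ws")
  case False
  then have "map_of (zip ws (map a [0..<length ws])) w = None"
    by simp
  then show ?thesis using False by (simp only: upd_def option.case if_False)
next
  case True
  let ?i = "var_index ws w"
  have "ws ! j \<noteq> w" if "j < ?i" for j
    using not_less_Least[of j "\<lambda>i. i < length ws \<and> ws ! i = w"] that var_index(1)[OF True]
    by (auto simp: var_index_def)
  then have "map_of (zip ws (map a [0..<length ws])) w = Some (map a [0..<length ws] ! ?i)"
    using var_index[OF True] map_of_zip_first[of ?i ws "map a [0..<length ws]"] by simp
  then have "upd \<omega> ws a w = map a [0..<length ws] ! ?i"
    by (simp only: upd_def option.case)
  then show ?thesis using True var_index(1)[OF True] by simp
qed

lemma continuous_on_upd:
  assumes "\<And>w. continuous_on S (\<lambda>t. G t w)" and "continuous_on S A"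
  shows "continuous_on S (\<lambda>t. upd (G t) ws (A t) w)"
proof (cases "w \<in> set ws")
  case True
  have "continuous_on S (\<lambda>t. A t i)" for i
    by (rule continuous_on_compose2[OF continuous_on_component[of UNIV] assms(2)]) simp
  then show ?thesis using True by (simp add: upd_apply)
qed (simp add: upd_apply assms(1))

text \<open>Peels off the head variable to match one quantifier of a block. If \<open>w\<close>
  recurred in \<open>ws\<close>, the left side would give it \<open>a 0\<close>, but the right side
  an entry of the tail.\<close>

lemma upd_Cons: "w \<notin> set ws \<Longrightarrow> upd \<omega> (w # ws) a = upd (fun_upd \<omega> w (a 0)) ws (\<lambda>i. a (Suc i))"
proof
  fix v assume w: "w \<notin> set ws"
  let ?m = "map_of (zip ws (map (\<lambda>i. a (Suc i)) [0..<length ws]))"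
  have "map a [0..<length (w # ws)] = a 0 # map (\<lambda>i. a (Suc i)) [0..<length ws]"
    by (simp add: map_upt_Suc del: upt_Suc)
  then have "map_of (zip (w # ws) (map a [0..<length (w # ws)])) = ?m(w \<mapsto> a 0)"
    by (simp del: upt_Suc)
  moreover have "?m w = None" using w by simp
  ultimately show "upd \<omega> (w # ws) a v = upd (fun_upd \<omega> w (a 0)) ws (\<lambda>i. a (Suc i)) v"
    unfolding upd_def by (cases "v = w")
      (simp_all only: fun_upd_same fun_upd_other not_False_eq_True option.case)
qed

text \<open>Truncation turns an arbitrary function, as produced by a quantifier block, into an
  element of the Euclidean space.\<close>

lemma upd_truncate: "upd \<omega> ws (\<lambda>i. if i < length ws then a i else 0) = upd \<omega> ws a"
  by (auto simp: upd_apply var_index)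

lemma topspace_Euclidean_space: "topspace (Euclidean_space n) = {a. \<forall>i\<ge>n. a i = 0}"
  by (simp add: Euclidean_space_def)

section \<open>Dependence of terms and formulas on the state\<close>

lemma trm_sem_coincidence:
  "(\<And>w. w \<in> trm_vars \<theta> \<Longrightarrow> \<omega> w = \<omega>' w) \<Longrightarrow> trm_sem \<theta> \<omega> = trm_sem \<theta> \<omega>'"
  by (induction \<theta>) auto

lemma continuous_on_trm_sem:
  "(\<And>w. continuous_on S (\<lambda>t. G t w)) \<Longrightarrow> continuous_on S (\<lambda>t. trm_sem \<theta> (G t))"
  by (induction \<theta>) (auto intro!: continuous_intros)

text \<open>Induction along \<open>fo_over\<close>, which adds the bound variable to
  \<open>W\<close>: two states given the same value there agree on the larger set.\<close>

lemma fo_coincidence: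
  "fo_over W \<phi> \<Longrightarrow> (\<And>w. w \<in> W \<Longrightarrow> \<omega> w = \<omega>' w) \<Longrightarrow> \<omega> \<in> fml_sem \<phi> \<longleftrightarrow> \<omega>' \<in> fml_sem \<phi>"
proof (induction W \<phi> arbitrary: \<omega> \<omega>' rule: fo_over.induct)
  case (1 W \<theta> \<eta>)
  then have "trm_sem \<theta> \<omega> = trm_sem \<theta> \<omega>'" "trm_sem \<eta> \<omega> = trm_sem \<eta> \<omega>'"
    by (auto intro!: trm_sem_coincidence)
  then show ?case by simp
next
  case (4 W w \<phi>)
  have "fun_upd \<omega> w r \<in> fml_sem \<phi> \<longleftrightarrow> fun_upd \<omega>' w r \<in> fml_sem \<phi>" for r
    using 4 by (intro "4.IH") auto
  then show ?case by simp
next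
  case (2 W \<phi>)
  from "2.IH"[of \<omega> \<omega>'] "2.prems" show ?case by simp
next
  case (3 W \<phi> \<psi>)
  from "3.IH"(1)[of \<omega> \<omega>'] "3.IH"(2)[of \<omega> \<omega>'] "3.prems" show ?case by simp
qed simp_all

section \<open>Semantics of implication, quantifier blocks and vector equations\<close>

lemma fml_sem_ImpF: "\<omega> \<in> fml_sem (ImpF \<phi> \<psi>) \<longleftrightarrow> (\<omega> \<in> fml_sem \<phi> \<longrightarrow> \<omega> \<in> fml_sem \<psi>)"
  by (simp add: ImpF_def)

lemma fml_sem_ExsF:
  "distinct ws \<Longrightarrow> \<omega> \<in> fml_sem (ExsF ws \<phi>) \<longleftrightarrow> (\<exists>a. upd \<omega> ws a \<in> fml_sem \<phi>)"
proof (induction ws arbitrary: \<omega>)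
  case Nil
  then show ?case by (simp add: ExsF_def upd_def)
next
  case (Cons w ws)
  have "\<omega> \<in> fml_sem (ExsF (w # ws) \<phi>) \<longleftrightarrow> (\<exists>r b. upd (fun_upd \<omega> w r) ws b \<in> fml_sem \<phi>)"
    using Cons by (simp add: ExsF_def)
  also have "\<dots> \<longleftrightarrow> (\<exists>a. upd (fun_upd \<omega> w (a 0)) ws (\<lambda>i. a (Suc i)) \<in> fml_sem \<phi>)"
  proof safe
    fix r b assume "upd (fun_upd \<omega> w r) ws b \<in> fml_sem \<phi>"
    then show "\<exists>a. upd (fun_upd \<omega> w (a 0)) ws (\<lambda>i. a (Suc i)) \<in> fml_sem \<phi>"
      by (intro exI[of _ "case_nat r b"]) simp
  qed blast
  finally show ?case using Cons.prems by (simp add: upd_Cons)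
qed

lemma fml_sem_AllsF:
  assumes "distinct ws"
  shows "\<omega> \<in> fml_sem (AllsF ws \<phi>) \<longleftrightarrow> (\<forall>a. upd \<omega> ws a \<in> fml_sem \<phi>)"
proof -
  have "fml_sem (AllsF ws \<phi>) = - fml_sem (ExsF ws (NotF \<phi>))"
    by (induction ws) (auto simp: AllsF_def ExsF_def AllF_def)
  then show ?thesis using fml_sem_ExsF[OF assms, of \<omega> "NotF \<phi>"] by auto
qed

lemma fml_sem_VecEqF:
  "length \<theta>s = length \<eta>s \<Longrightarrow>
    \<omega> \<in> fml_sem (VecEqF \<theta>s \<eta>s) \<longleftrightarrow> (\<forall>i<length \<theta>s. trm_sem (\<theta>s ! i) \<omega> = trm_sem (\<eta>s ! i) \<omega>)"
proof (induction \<theta>s \<eta>s rule: list_induct2)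
  case Nil
  then show ?case by (simp add: VecEqF_def TrueF_def)
next
  case (Cons \<theta> \<theta>s \<eta> \<eta>s)
  then show ?case by (auto simp: VecEqF_def EqF_def less_Suc_eq_0_disj)
qed

section \<open>Regions of control values and continuity of the right-hand side\<close>

lemma region_coincidence:
  assumes "fo_over (set ws) \<phi>" "a \<in> topspace (Euclidean_space (length ws))"
  shows "upd \<omega>' ws a \<in> fml_sem \<phi> \<longleftrightarrow> a \<in> region \<omega> ws (fml_sem \<phi>)"
proof -
  have "upd \<omega>' ws a \<in> fml_sem \<phi> \<longleftrightarrow> upd \<omega> ws a \<in> fml_sem \<phi>"
    by (rule fo_coincidence[OF assms(1)]) (simp add: upd_apply)
  then show ?thesis using assms(2) by (simp add: region_def)
qed

lemma region_vanish: "a \<in> region \<omega> ws S \<Longrightarrow> length ws \<le> i \<Longrightarrow> a i = 0"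
  by (simp add: region_def topspace_Euclidean_space)

lemma compact_of_compactin_Euclidean_space:
  "compactin (Euclidean_space n) S \<Longrightarrow> compact S"
  by (simp add: Euclidean_space_def compactin_subtopology euclidean_product_topology)

lemma continuous_on_rhs:
  assumes "continuous_on S B" "continuous_on S C"
  shows "continuous_on S (\<lambda>t. rhs x f y z \<omega> a (B t) (C t) i)"
  unfolding rhs_def
  by (intro continuous_on_trm_sem continuous_on_upd assms continuous_on_const)


section \<open>Strategy transfer\<close>

lemma restrict_in_controls:
  assumes "\<phi> \<in> borel_measurable (lebesgue_on {0..T})" "\<And>t. t \<in> {0..T} \<Longrightarrow> \<phi> t \<in> B"
  shows "restrict \<phi> {0..T} \<in> controls T B"
proof -
  have "restrict \<phi> {0..T} \<in> borel_measurable (lebesgue_on {0..T})"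
    using assms(1) by (rule measurable_cong[THEN iffD1, rotated]) simp
  then show ?thesis using assms(2) by (simp add: controls_def)
qed

lemma controlsD:
  assumes "p \<in> controls T A"
  shows "p \<in> borel_measurable (lebesgue_on {0..T})" "t \<in> {0..T} \<Longrightarrow> p t \<in> A"
  using assms by (auto simp: controls_def)

lemma control_compose:
  assumes "p \<in> controls T A" "h \<in> borel_measurable (restrict_space borel A)" "h \<in> A \<rightarrow> B"
  shows "(\<lambda>t\<in>{0..T}. h (p t)) \<in> controls T B"
proof (rule restrict_in_controls)
  have "p \<in> measurable (lebesgue_on {0..T}) (restrict_space borel A)"
    using controlsD[OF assms(1)] by (intro measurable_restrict_space2) auto
  then show "(\<lambda>t. h (p t)) \<in> borel_measurable (lebesgue_on {0..T})"
    using assms(2) by (rule measurable_compose)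
qed (use controlsD[OF assms(1)] assms(3) in auto)

text \<open>Both \<open>h\<close> and \<open>k\<close> act pointwise in time, so agreement of two
  controls up to \<open>s\<close> passes to the inputs of \<open>\<beta>\<close>, by its
  nonanticipativity to its outputs, and then to the values of \<open>k\<close>. Borel maps preserve
  Lebesgue measurability under composition.\<close>

lemma strategy_transfer:
  fixes h :: "vec \<Rightarrow> vec" and k :: "vec \<times> vec \<times> vec \<Rightarrow> vec"
  assumes "\<beta> \<in> strategies T B C"
    and h: "h \<in> borel_measurable (restrict_space borel A)" "h \<in> A \<rightarrow> B"
    and k: "k \<in> borel_measurable (restrict_space borel P)"
    and P: "\<And>a c. a \<in> A \<Longrightarrow> c \<in> C \<Longrightarrow> (a, h a, c) \<in> P \<and> k (a, h a, c) \<in> D"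
  shows "(\<lambda>p\<in>controls T A. \<lambda>t\<in>{0..T}. k (p t, h (p t), \<beta> (\<lambda>t\<in>{0..T}. h (p t)) t))
    \<in> strategies T A D" (is "(\<lambda>p\<in>_. ?\<gamma> p) \<in> _")
proof -
  let ?H = "\<lambda>p. \<lambda>t\<in>{0..T}. h (p t)"
  have H: "?H p \<in> controls T B" if "p \<in> controls T A" for p
    using control_compose[OF that h] .
  have \<beta>: "\<beta> q \<in> controls T C" if "q \<in> controls T B" for q
    using assms(1) that by (auto simp: strategies_def)
  have nonant: "AE t in lebesgue_on {0..s}. \<beta> q t = \<beta> q' t"
    if "s \<in> {0..T}" "q \<in> controls T B" "q' \<in> controls T B" "AE t in lebesgue_on {0..s}. q t = q' t"
    for s q q'
    using assms(1) that unfolding strategies_def by blast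
  have "?\<gamma> p \<in> controls T D" if p: "p \<in> controls T A" for p
  proof (rule restrict_in_controls)
    let ?L = "lebesgue_on {0..T}"
    note [measurable] = controlsD(1)[OF p] controlsD(1)[OF \<beta>[OF H[OF p]]]
    have "(\<lambda>t. h (p t)) \<in> borel_measurable ?L"
      using controlsD(1)[OF H[OF p]] by (rule measurable_cong[THEN iffD1, rotated]) simp
    then have "(\<lambda>t. (p t, h (p t), \<beta> (?H p) t)) \<in> borel_measurable ?L"
      by (intro borel_measurable_Pair) auto
    \<comment> \<open>\<open>k\<close> is Borel only relative to \<open>P\<close>, so the triple has
      to be measurable as a map into \<open>P\<close>.\<close>
    then have "(\<lambda>t. (p t, h (p t), \<beta> (?H p) t)) \<in> measurable ?L (restrict_space borel P)"
      using P controlsD(2)[OF p] controlsD(2)[OF \<beta>[OF H[OF p]]]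
      by (intro measurable_restrict_space2) auto
    then show "(\<lambda>t. k (p t, h (p t), \<beta> (?H p) t)) \<in> borel_measurable ?L"
      using k by (rule measurable_compose)
  qed (use P controlsD(2)[OF p] controlsD(2)[OF \<beta>[OF H[OF p]]] in blast)
  moreover have "AE t in lebesgue_on {0..s}. ?\<gamma> p t = ?\<gamma> q t"
    if s: "s \<in> {0..T}" and p: "p \<in> controls T A" and q: "q \<in> controls T A"
      and eq: "AE t in lebesgue_on {0..s}. p t = q t" for s p q
  proof -
    have "AE t in lebesgue_on {0..s}. ?H p t = ?H q t"
      \<comment> \<open>Off \<open>{0..T}\<close> both restrictions are \<open>undefined\<close>, so
        equality of \<open>p t\<close> and \<open>q t\<close> suffices at every
        \<open>t\<close>.\<close>
      using eq by eventually_elim (simp add: restrict_def)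
    from nonant[OF s H[OF p] H[OF q] this] eq show ?thesis
      by eventually_elim (simp add: restrict_def)
  qed
  ultimately show ?thesis by (auto simp: strategies_def)
qed

text \<open>The two responses are the same description, so existence and uniqueness of solutions are
  irrelevant.\<close>

lemma response_cong:
  assumes "\<And>s a i. s \<in> {0..T} \<Longrightarrow> i < length x \<Longrightarrow>
    rhs x f y z \<omega> a (p s) (q s) i = rhs x g u v \<omega> a (p' s) (q' s) i"
  shows "response x f y z \<omega> T p q = response x g u v \<omega> T p' q'"
proof -
  have "caratheodory_solution x f y z \<omega> T p q = caratheodory_solution x g u v \<omega> T p' q'"
    unfolding caratheodory_solution_def
    by (intro ext conj_cong refl AE_cong) (simp add: assms cong: all_cong)
  then show ?thesis by (simp add: response_def fun_eq_iff)
qed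

text \<open>The matrix of the premise at fixed control values. The position \<open>e\<close> is
  quantified inside, so a choice of \<open>d\<close> cannot depend on it, and the velocities agree
  along every trajectory.\<close>

definition simulates where
  "simulates x f y z g u v \<omega> a b c d \<longleftrightarrow>
    (\<forall>e. \<forall>i<length x. rhs x f y z \<omega> e b c i = rhs x g u v \<omega> e a d i)"

text \<open>For each \<open>e\<close> and \<open>i\<close> both sides are continuous in the control
  values, so the relation is an intersection of closed equality sets.\<close>

lemma closed_simulates:
  "closed {t. simulates x f y z g u v \<omega> (fst (fst t)) (fst (snd (fst t))) (snd (snd (fst t))) (snd t)}"
  unfolding simulates_def
  by (intro closed_Collect_all closed_Collect_imp open_Collect_const closed_Collect_eq
      continuous_on_rhs continuous_on_fst continuous_on_snd continuous_on_id)

text \<open>Compactness survives both inner quantifiers: the existential over \<open>D\<close> is a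
  projection, the universal over \<open>C\<close> an intersection of closed preimages. So
  \<open>compact_relation_selection\<close> applies twice. Since \<open>k\<close> takes
  \<open>b\<close> as an argument, it is selected independently of \<open>h\<close>.\<close>

lemma simulation_selectors:
  fixes A B C D :: "vec set"
  assumes "compact A" "compact B" "compact C" "compact D"
    and vanish: "\<And>b i. b \<in> B \<Longrightarrow> m \<le> i \<Longrightarrow> b i = 0" "\<And>d i. d \<in> D \<Longrightarrow> n \<le> i \<Longrightarrow> d i = 0"
    and closed: "closed {t. S (fst (fst t)) (fst (snd (fst t))) (snd (snd (fst t))) (snd t)}"
    and sim: "\<And>a. a \<in> A \<Longrightarrow> \<exists>b\<in>B. \<forall>c\<in>C. \<exists>d\<in>D. S a b c d"
  obtains h k P where "h \<in> borel_measurable (restrict_space borel A)" "h \<in> A \<rightarrow> B"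
    and "k \<in> borel_measurable (restrict_space borel P)"
    and "\<And>a c. a \<in> A \<Longrightarrow> c \<in> C \<Longrightarrow> (a, h a, c) \<in> P \<and> k (a, h a, c) \<in> D \<and> S a (h a) c (k (a, h a, c))"
proof -
  \<comment> \<open>The nesting \<open>((a, b, c), d)\<close> lets \<open>fst\<close> project away
    \<open>d\<close>.\<close>
  define K where "K = ((A \<times> B \<times> C) \<times> D) \<inter>
    {t. S (fst (fst t)) (fst (snd (fst t))) (snd (snd (fst t))) (snd t)}"
  have K: "compact K" unfolding K_def
    using assms(1-4) closed by (intro compact_Int_closed compact_Times)
  then have P: "closed (fst ` K)"
    by (intro compact_imp_closed compact_continuous_image continuous_intros)
  define R where "R = (A \<times> B) \<inter> (\<Inter>c\<in>C. (\<lambda>(a, b). (a, b, c)) -` (fst ` K))"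
  have "continuous_on UNIV (\<lambda>(a, b). (a, b, c))" for c :: vec
    unfolding case_prod_beta
    by (intro continuous_on_Pair continuous_on_fst continuous_on_snd continuous_on_id continuous_on_const)
  then have "compact R" unfolding R_def
    using assms(1,2) P by (intro compact_Int_closed compact_Times closed_INT ballI closed_vimage)
  have R_iff: "(a, b) \<in> R \<longleftrightarrow> a \<in> A \<and> b \<in> B \<and> (\<forall>c\<in>C. \<exists>d\<in>D. S a b c d)" for a b
    by (force simp: R_def K_def)
  \<comment> \<open>By \<open>sim\<close> every \<open>a\<close> has a partner, so the selection
    from \<open>R\<close> is defined on all of \<open>A\<close>.\<close>
  have fst_R: "fst ` R = A"
  proof
    show "fst ` R \<subseteq> A" by (auto simp: R_def)
    show "A \<subseteq> fst ` R"
    proof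
      fix a assume "a \<in> A"
      then obtain b where "(a, b) \<in> R" using sim R_iff by blast
      then show "a \<in> fst ` R" by (rule image_eqI[rotated]) simp
    qed
  qed
  obtain h where h: "h \<in> borel_measurable (restrict_space borel A)" "\<And>a. a \<in> A \<Longrightarrow> (a, h a) \<in> R"
  proof (rule compact_relation_selection[OF \<open>compact R\<close>, of m, unfolded fst_R])
    show "p i = 0" if "(a, p) \<in> R" "m \<le> i" for a p i using that vanish(1) by (simp add: R_def)
  qed blast
  obtain k where k: "k \<in> borel_measurable (restrict_space borel (fst ` K))"
    "\<And>t. t \<in> fst ` K \<Longrightarrow> (t, k t) \<in> K"
  proof (rule compact_relation_selection[OF K, of n])
    show "p i = 0" if "(a, p) \<in> K" "n \<le> i" for a p i using that vanish(2) by (simp add: K_def)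
  qed blast
  show ?thesis
  proof (rule that[OF h(1) _ k(1)])
    show "h \<in> A \<rightarrow> B" using h(2) R_iff by blast
    fix a c assume "a \<in> A" "c \<in> C"
    then have "(a, h a, c) \<in> fst ` K" using h(2) by (force simp: R_def)
    then show "(a, h a, c) \<in> fst ` K \<and> k (a, h a, c) \<in> D \<and> S a (h a) c (k (a, h a, c))"
      using k(2) by (force simp: K_def)
  qed
qed

text \<open>The formula sees only \<open>ws\<close>, and \<open>upd\<close> reads only the first
  \<open>length ws\<close> entries. A quantifier witness found in one state can therefore be
  truncated to an element of the region taken at another.\<close>

lemma upd_to_region:
  assumes "upd \<omega>' ws a \<in> fml_sem \<phi>" "fo_over (set ws) \<phi>"
  obtains b where "b \<in> region \<omega> ws (fml_sem \<phi>)" "\<And>\<tau>. upd \<tau> ws a = upd \<tau> ws b"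
proof -
  let ?b = "\<lambda>i. if i < length ws then a i else 0"
  have "?b \<in> topspace (Euclidean_space (length ws))" by (simp add: topspace_Euclidean_space)
  then have "?b \<in> region \<omega> ws (fml_sem \<phi>)"
    using region_coincidence[OF assms(2)] assms(1) upd_truncate by metis
  then show ?thesis using that upd_truncate by metis
qed

text \<open>The quantifier prefix is unwound block by block at \<open>\<omega>\<close>, each
  existential witness being moved into its region by \<open>upd_to_region\<close>.\<close>

lemma simulates_of_valid:
  assumes dist: "distinct (x @ y @ z @ u @ v)"
    and wff: "wf_dgame x f y Y z Z" and wfg: "wf_dgame x g u U v V"
    and valid: "valid (AllsF u (ImpF U (ExsF y (AndF Y (AllsF z (ImpF Z (ExsF v (AndF V
                  (AllsF x (VecEqF f g))))))))))"
    and a: "a \<in> region \<omega> u (fml_sem U)"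
  shows "\<exists>b\<in>region \<omega> y (fml_sem Y). \<forall>c\<in>region \<omega> z (fml_sem Z). \<exists>d\<in>region \<omega> v (fml_sem V).
    simulates x f y z g u v \<omega> a b c d"
proof -
  have fo: "fo_over (set u) U" "fo_over (set y) Y" "fo_over (set z) Z" "fo_over (set v) V"
    using wff wfg by (auto simp: wf_dgame_def)
  have len: "length f = length x" "length g = length x"
    and vars: "\<And>i. i < length x \<Longrightarrow> trm_vars (f ! i) \<subseteq> set x \<union> set y \<union> set z"
      "\<And>i. i < length x \<Longrightarrow> trm_vars (g ! i) \<subseteq> set x \<union> set u \<union> set v"
    using wff wfg unfolding wf_dgame_def by (metis nth_mem)+
  have d: "distinct x" "distinct y" "distinct z" "distinct u" "distinct v" using dist by auto
  have "upd \<omega> u a \<in> fml_sem U" using a by (simp add: region_def)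
  then obtain b' where b': "upd (upd \<omega> u a) y b' \<in> fml_sem Y"
    and sim': "upd (upd \<omega> u a) y b' \<in> fml_sem (AllsF z (ImpF Z (ExsF v (AndF V (AllsF x (VecEqF f g))))))"
    using valid unfolding valid_def fml_sem_AllsF[OF d(4)] fml_sem_ImpF[of _ U]
      fml_sem_ExsF[OF d(2)] fml_sem.simps(3) by blast
  obtain b where b: "b \<in> region \<omega> y (fml_sem Y)" and b_eq: "\<And>\<tau>. upd \<tau> y b' = upd \<tau> y b"
    using upd_to_region[OF b' fo(2)] by blast
  have sim: "upd (upd (upd \<omega> u a) y b) z c \<in> fml_sem (ExsF v (AndF V (AllsF x (VecEqF f g))))"
    if "upd (upd (upd \<omega> u a) y b) z c \<in> fml_sem Z" for c
    using sim' that unfolding b_eq fml_sem_AllsF[OF d(3)] fml_sem_ImpF[of _ Z] by blast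
  show ?thesis
  proof (intro bexI[OF _ b] ballI)
    fix c assume c: "c \<in> region \<omega> z (fml_sem Z)"
    let ?\<tau> = "upd (upd (upd \<omega> u a) y b) z c"
    have "?\<tau> \<in> fml_sem Z"
      using region_coincidence[OF fo(3), of c "upd (upd \<omega> u a) y b" \<omega>] c by (simp add: region_def)
    from sim[OF this] obtain d' where d': "upd ?\<tau> v d' \<in> fml_sem V"
      and eq': "\<And>e. upd (upd ?\<tau> v d') x e \<in> fml_sem (VecEqF f g)"
      unfolding fml_sem_ExsF[OF d(5)] fml_sem.simps(3) Int_iff fml_sem_AllsF[OF d(1)] by blast
    obtain d where dV: "d \<in> region \<omega> v (fml_sem V)" and d_eq: "\<And>\<tau>. upd \<tau> v d' = upd \<tau> v d"
      using upd_to_region[OF d' fo(4)] by blast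
    note eq = eq'[unfolded d_eq]
    have "rhs x f y z \<omega> e b c i = rhs x g u v \<omega> e a d i" if i: "i < length x" for e i
    proof -
      \<comment> \<open>The premise updates \<open>x\<close> last and sets all the controls, whereas
        \<open>rhs\<close> updates \<open>x\<close> first and sets only the controls of one game.
        Distinctness and the variable conditions on \<open>f\<close> and \<open>g\<close> make the
        values agree.\<close>
      let ?\<sigma> = "upd (upd ?\<tau> v d) x e"
      have "rhs x f y z \<omega> e b c i = trm_sem (f ! i) ?\<sigma>"
        unfolding rhs_def
      proof (rule trm_sem_coincidence)
        fix w assume "w \<in> trm_vars (f ! i)"
        then have "w \<in> set x \<union> set y \<union> set z" using vars(1)[OF i] by blast
        then show "upd (upd (upd \<omega> x e) y b) z c w = ?\<sigma> w"
          using dist by (auto simp: upd_apply)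
      qed
      also have "\<dots> = trm_sem (g ! i) ?\<sigma>"
        using eq[of e] i len by (simp add: fml_sem_VecEqF)
      also have "\<dots> = rhs x g u v \<omega> e a d i"
        unfolding rhs_def
      proof (rule trm_sem_coincidence)
        fix w assume "w \<in> trm_vars (g ! i)"
        then have "w \<in> set x \<union> set u \<union> set v" using vars(2)[OF i] by blast
        then show "?\<sigma> w = upd (upd (upd \<omega> x e) u a) v d w"
          using dist by (auto simp: upd_apply)
      qed
      finally show ?thesis .
    qed
    then show "\<exists>d\<in>region \<omega> v (fml_sem V). simulates x f y z g u v \<omega> a b c d"
      using dV by (auto simp: simulates_def)
  qed
qed

theorem theorem5p2:
  fixes x y z u v :: "ident list" and f g :: "trm list" and Y Z U V :: fml
  assumes "distinct (x @ y @ z @ u @ v)"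
    and "wf_dgame x f y Y z Z"
    and "wf_dgame x g u U v V"
    and "valid (AllsF u (ImpF U (ExsF y (AndF Y (AllsF z (ImpF Z (ExsF v (AndF V
                  (AllsF x (VecEqF f g))))))))))"
  shows "\<forall>F. wf_fml F \<longrightarrow> valid (ImpF (Box (DGame x g u U v V) F) (Box (DGame x f y Y z Z) F))"
proof -
  \<comment> \<open>The formula \<open>F\<close> enters only through its semantics, so the winning
    regions are compared for an arbitrary set \<open>X\<close>.\<close>
  have "\<omega> \<in> demon (DGame x f y Y z Z) X" if g: "\<omega> \<in> demon (DGame x g u U v V) X" for \<omega> X
  proof -
    let ?A = "region \<omega> u (fml_sem U)" and ?B = "region \<omega> y (fml_sem Y)"
    let ?C = "region \<omega> z (fml_sem Z)" and ?D = "region \<omega> v (fml_sem V)"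
    have cpt: "compact ?A" "compact ?B" "compact ?C" "compact ?D"
      using assms(2,3) by (auto simp: wf_dgame_def intro: compact_of_compactin_Euclidean_space)
    obtain h k P where h: "h \<in> borel_measurable (restrict_space borel ?A)" "h \<in> ?A \<rightarrow> ?B"
      and k: "k \<in> borel_measurable (restrict_space borel P)"
      and P: "\<And>a c. a \<in> ?A \<Longrightarrow> c \<in> ?C \<Longrightarrow> (a, h a, c) \<in> P \<and> k (a, h a, c) \<in> ?D \<and>
        simulates x f y z g u v \<omega> a (h a) c (k (a, h a, c))"
    proof (rule simulation_selectors[OF cpt, where S = "simulates x f y z g u v \<omega>"
          and m = "length y" and n = "length v"])
    qed (blast intro: region_vanish closed_simulates simulates_of_valid[OF assms])+
    show ?thesis
      unfolding demon.simps
    proof (intro CollectI allI impI ballI)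
      fix T :: real and \<beta> assume T: "T \<ge> 0" and \<beta>: "\<beta> \<in> strategies T ?B ?C"
      let ?H = "\<lambda>p. \<lambda>t\<in>{0..T}. h (p t)"
      let ?\<gamma> = "\<lambda>p\<in>controls T ?A. \<lambda>t\<in>{0..T}. k (p t, h (p t), \<beta> (?H p) t)"
      have "?\<gamma> \<in> strategies T ?A ?D" using strategy_transfer[OF \<beta> h k] P by blast
      then obtain p where p: "p \<in> controls T ?A"
        and safe: "\<And>\<zeta>. \<zeta> \<in> {0..T} \<Longrightarrow> response x g u v \<omega> T p (?\<gamma> p) \<zeta> \<in> X"
        using g T unfolding demon.simps by blast
      have H: "?H p \<in> controls T ?B" using control_compose[OF p h] .
      then have \<beta>H: "\<beta> (?H p) \<in> controls T ?C" using \<beta> by (auto simp: strategies_def)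
      have "response x f y z \<omega> T (?H p) (\<beta> (?H p)) = response x g u v \<omega> T p (?\<gamma> p)"
      proof (rule response_cong)
        fix s e i assume s: "s \<in> {0..T}" and i: "i < length x"
        \<comment> \<open>Controls take values in their regions at every time, not just almost every
          time, so the simulation holds throughout \<open>{0..T}\<close>.\<close>
        have "simulates x f y z g u v \<omega> (p s) (h (p s)) (\<beta> (?H p) s) (k (p s, h (p s), \<beta> (?H p) s))"
          using P controlsD(2)[OF p s] controlsD(2)[OF \<beta>H s] by blast
        then show "rhs x f y z \<omega> e (?H p s) (\<beta> (?H p) s) i = rhs x g u v \<omega> e (p s) (?\<gamma> p s) i"
          using s i p by (simp add: simulates_def)
      qed
      then show "\<exists>p\<in>controls T ?B. \<forall>\<zeta>\<in>{0..T}. response x f y z \<omega> T p (\<beta> p) \<zeta> \<in> X"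
        using H safe by metis
    qed
  qed
  then show ?thesis by (auto simp: valid_def fml_sem_ImpF)
qed

end
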